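(* Let $\mathscr{H}$ be a complex Hilbert space and let $S\in\mathscr{B}(\mathscr{H})$. Then $$w_{\rm e}(S,S^*S)=dw(S).$$
   Context: $\mathscr{B}(\mathscr{H})$ is the algebra of bounded linear operators on $\mathscr{H}$. For $T_1,\dots,T_n\in\mathscr{B}(\mathscr{H})$ the Euclidean operator radius is $w_{\rm e}(T_1,\dots,T_n)=\sup_{\|x\|=1}\left(\sum_{i=1}^n|\langle T_ix,x\rangle|^2\right)^{1/2}$. The Davis--Wielandt radius of $S$ is $dw(S)=\sup_{\|x\|=1}\sqrt{|\langle Sx,x\rangle|^2+\|Sx\|^4}$. Suprema are over unit vectors $x\in\mathscr{H}$. *)

theory Defs
  imports "HOL-Analysis.Analysis"
begin

class complex_vector = real_vector +
  fixes scaleC :: "complex \<Rightarrow> 'a \<Rightarrow> 'a"  (infixr \<open>*\<^sub>C\<close> 75)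
  assumes scaleC_add_right: "a *\<^sub>C (x + y) = a *\<^sub>C x + a *\<^sub>C y"
    and scaleC_add_left: "(a + b) *\<^sub>C x = a *\<^sub>C x + b *\<^sub>C x"
    and scaleC_scaleC: "a *\<^sub>C (b *\<^sub>C x) = (a * b) *\<^sub>C x"
    and scaleC_one: "1 *\<^sub>C x = x"
    and scaleR_scaleC: "r *\<^sub>R x = complex_of_real r *\<^sub>C x"

(* The inner product is linear in its first argument. Its values on the diagonal are real by
   conjugate symmetry, so the real part loses nothing. *)
class complex_inner = complex_vector + real_normed_vector +
  fixes cinner :: "'a \<Rightarrow> 'a \<Rightarrow> complex"
  assumes cinner_commute: "cinner x y = cnj (cinner y x)"
    and cinner_add_left: "cinner (x + y) z = cinner x z + cinner y z"
    and cinner_scaleC_left: "cinner (a *\<^sub>C x) y = a * cinner x y"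
    and cinner_ge_zero: "0 \<le> Re (cinner x x)"
    and cinner_eq_zero_iff: "cinner x x = 0 \<longleftrightarrow> x = 0"
    and norm_eq_sqrt_cinner: "norm x = sqrt (Re (cinner x x))"

class complex_hilbert_space = complex_inner + complete_space

instantiation complex :: complex_hilbert_space
begin

definition scaleC_complex :: "complex \<Rightarrow> complex \<Rightarrow> complex"
  where "scaleC_complex a x = a * x"

definition cinner_complex :: "complex \<Rightarrow> complex \<Rightarrow> complex"
  where "cinner_complex x y = x * cnj y"

instance
  by standard
    (auto simp: scaleC_complex_def cinner_complex_def algebra_simps scaleR_conv_of_real
      cmod_def power2_eq_square)

end

definition bounded_clinear :: "('a::complex_inner \<Rightarrow> 'b::complex_inner) \<Rightarrow> bool"
  where "bounded_clinear S \<longleftrightarrow>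
    bounded_linear S \<and> (\<forall>c x. S (c *\<^sub>C x) = c *\<^sub>C S x)"

(* For bounded_clinear S on a Hilbert space, such a T exists by the Riesz representation theorem
   and is unique; for other S the value is unspecified. *)
definition cadjoint :: "('a::complex_hilbert_space \<Rightarrow> 'a) \<Rightarrow> 'a \<Rightarrow> 'a"
  where "cadjoint S =
    (THE T. bounded_clinear T \<and> (\<forall>x y. cinner (S x) y = cinner x (T y)))"

(* The tuple of operators is a list. In both radii the supremum is that of the reals: it is the
   intended one for bounded operators on a nonzero space, while on the zero space, which has no
   unit vectors, both radii are the same unspecified real Sup {}. *)
definition euclidean_operator_radius :: "('a::complex_inner \<Rightarrow> 'a) list \<Rightarrow> real"
  where "euclidean_operator_radius Ts =
    (SUP x\<in>{x. norm x = 1}. sqrt (\<Sum>T\<leftarrow>Ts. (cmod (cinner (T x) x))\<^sup>2))"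

definition davis_wielandt_radius :: "('a::complex_inner \<Rightarrow> 'a) \<Rightarrow> real"
  where "davis_wielandt_radius S =
    (SUP x\<in>{x. norm x = 1}. sqrt ((cmod (cinner (S x) x))\<^sup>2 + norm (S x) ^ 4))"

end

(* The adjoint is obtained from the Riesz representation theorem, proved by minimising
   Q x = |x|^2 - 2 g x: the parallelogram law makes every minimising sequence Cauchy, and the
   stationarity of Q at the minimiser z reads g x = Re <x, z>.  Given the adjoint,
   |<S* S x, x>| = |S x|^2, so the two suprema are taken over the same function. *)
theory Submission
  imports Defs
begin

lemma cinner_add_right:
  fixes x :: "'a::complex_inner"
  shows "cinner x (y + z) = cinner x y + cinner x z"
  by (metis cinner_add_left cinner_commute complex_cnj_add)

lemma cinner_scaleC_right:
  fixes x :: "'a::complex_inner"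
  shows "cinner x (a *\<^sub>C y) = cnj a * cinner x y"
  by (metis cinner_scaleC_left cinner_commute complex_cnj_mult)

lemma cinner_scaleR_left:
  fixes x :: "'a::complex_inner"
  shows "cinner (r *\<^sub>R x) y = complex_of_real r * cinner x y"
  by (simp add: scaleR_scaleC cinner_scaleC_left)

lemma cinner_scaleR_right:
  fixes x :: "'a::complex_inner"
  shows "cinner x (r *\<^sub>R y) = complex_of_real r * cinner x y"
  by (simp add: scaleR_scaleC cinner_scaleC_right)

lemma cinner_minus_right:
  fixes x :: "'a::complex_inner"
  shows "cinner x (- y) = - cinner x y"
  using cinner_scaleR_right[of x "-1" y] by simp

lemma cinner_diff_right:
  fixes x :: "'a::complex_inner"
  shows "cinner x (y - z) = cinner x y - cinner x z"
  using cinner_add_right[of x y "- z"] by (simp add: cinner_minus_right)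

lemma cinner_self:
  fixes x :: "'a::complex_inner"
  shows "cinner x x = complex_of_real ((norm x)\<^sup>2)"
proof (rule complex_eqI)
  show "Re (cinner x x) = Re (complex_of_real ((norm x)\<^sup>2))"
    by (simp add: norm_eq_sqrt_cinner cinner_ge_zero)
  have "Im (cinner x x) = - Im (cinner x x)"
    using arg_cong[OF cinner_commute[of x x], of Im] by simp
  then show "Im (cinner x x) = Im (complex_of_real ((norm x)\<^sup>2))"
    by simp
qed

lemma Re_cinner_commute:
  fixes x :: "'a::complex_inner"
  shows "Re (cinner x y) = Re (cinner y x)"
  by (metis cinner_commute complex_cnj(1) complex.collapse complex.sel(1))

lemma norm_add_square:
  fixes x :: "'a::complex_inner"
  shows "(norm (x + y))\<^sup>2 = (norm x)\<^sup>2 + 2 * Re (cinner x y) + (norm y)\<^sup>2"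
proof -
  have *: "(norm u)\<^sup>2 = Re (cinner u u)" for u :: 'a
    by (simp add: cinner_self)
  show ?thesis
    unfolding * by (simp add: cinner_add_left cinner_add_right Re_cinner_commute[of y x])
qed

lemma parallelogram_law:
  fixes x :: "'a::complex_inner"
  shows "(norm (x + y))\<^sup>2 + (norm (x - y))\<^sup>2 = 2 * (norm x)\<^sup>2 + 2 * (norm y)\<^sup>2"
  using norm_add_square[of x y] norm_add_square[of x "- y"] by (simp add: cinner_minus_right)

text \<open>The real part of Cauchy-Schwarz comes from squaring the triangle inequality, which is
  part of the normed space structure, and expanding the left side.\<close>

lemma Re_cinner_le_norm:
  fixes x :: "'a::complex_inner"
  shows "Re (cinner x y) \<le> norm x * norm y"
proof -
  have "(norm (x + y))\<^sup>2 \<le> (norm x + norm y)\<^sup>2"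
    by (simp add: norm_triangle_ineq power_mono)
  then show ?thesis
    by (simp add: norm_add_square power2_sum)
qed

lemma abs_Re_cinner_le_norm:
  fixes x :: "'a::complex_inner"
  shows "\<bar>Re (cinner x y)\<bar> \<le> norm x * norm y"
  using Re_cinner_le_norm[of x y] Re_cinner_le_norm[of x "- y"]
  by (simp add: cinner_minus_right)

lemma cinner_ext:
  fixes u v :: "'a::complex_inner"
  assumes "\<And>x. cinner x u = cinner x v"
  shows "u = v"
  using assms[of "u - v"] cinner_eq_zero_iff[of "u - v"] by (simp add: cinner_diff_right)

text \<open>First-order condition at an interior minimum: the quadratic in \<open>t\<close> vanishes
  at 0 and is nonnegative, so its derivative \<open>a\<close> there is zero.\<close>

lemma linear_coeff_eq_0:
  fixes a b :: real
  assumes "\<And>t. 0 \<le> t * a + t\<^sup>2 * b"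
  shows "a = 0"
proof -
  have "\<not> b \<le> 0" if "a \<noteq> 0"
  proof
    assume "b \<le> 0"
    have "t * a + t\<^sup>2 * b < 0" if "t * a < 0" for t
      using that mult_nonneg_nonpos[of "t\<^sup>2" b] \<open>b \<le> 0\<close> by simp
    moreover have "(- a) * a < 0"
      using \<open>a \<noteq> 0\<close> by (simp flip: power2_eq_square)
    ultimately show False
      using assms[of "- a"] by fastforce
  qed
  \<comment> \<open>For \<open>b > 0\<close> the vertex of the parabola is at
    \<open>- a / (2 * b)\<close>, with value \<open>- a\<^sup>2 / (4 * b)\<close>.\<close>
  moreover have "a = 0" if "b > 0"
    using assms[of "- a / (2 * b)"] that
    by (auto simp: field_simps power2_eq_square mult_le_0_iff)
  ultimately show ?thesis
    by force
qed

lemma real_riesz_representation: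
  fixes g :: "'a::complex_hilbert_space \<Rightarrow> real"
  assumes "bounded_linear g"
  shows "\<exists>z. \<forall>x. g x = Re (cinner x z)"
proof -
  interpret g: bounded_linear g by fact
  obtain K where K: "\<And>x. norm (g x) \<le> norm x * K"
    using g.bounded by blast
  define Q where "Q x = (norm x)\<^sup>2 - 2 * g x" for x
  define m where "m = Inf (range Q)"
  \<comment> \<open>Completing the square in \<open>norm x\<close>. The bound makes \<open>m\<close>
    a genuine infimum.\<close>
  have "- K\<^sup>2 \<le> Q x" for x
  proof -
    have "0 \<le> (norm x - K)\<^sup>2" by simp
    moreover have "g x \<le> norm x * K" using K[of x] by simp
    ultimately show ?thesis by (simp add: Q_def power2_diff)
  qed
  then have "bdd_below (range Q)"
    by (rule bdd_belowI2)
  then have m_le: "m \<le> Q x" for x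
    unfolding m_def by (simp add: cInf_lower)
  have "\<exists>x. Q x < m + 1 / real (Suc n)" for n
    using cInf_lessD[of "range Q" "m + 1 / real (Suc n)"] by (auto simp: m_def)
  then obtain X where X: "\<And>n. Q (X n) < m + 1 / real (Suc n)"
    by metis
  \<comment> \<open>The midpoint also has value at least \<open>m\<close>, so by the parallelogram
    law two points with nearly minimal values are close together.\<close>
  have dist_bound: "(norm (x - y))\<^sup>2 \<le> 2 * (Q x + Q y - 2 * m)" for x y
  proof -
    have "4 * Q ((1/2) *\<^sub>R (x + y)) = (norm (x + y))\<^sup>2 - 4 * (g x + g y)"
      by (simp add: Q_def g.scaleR g.add power_divide add_divide_distrib)
    then have "(norm (x - y))\<^sup>2 = 2 * Q x + 2 * Q y - 4 * Q ((1/2) *\<^sub>R (x + y))"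
      using parallelogram_law[of x y] by (simp add: Q_def)
    then show ?thesis
      using m_le[of "(1/2) *\<^sub>R (x + y)"] by simp
  qed
  have "Cauchy X"
  proof (rule metric_CauchyI)
    fix e :: real
    assume "0 < e"
    \<comment> \<open>Two excesses over \<open>m\<close> below \<open>e\<^sup>2 / 4\<close>, doubled
      by \<open>dist_bound\<close>, add up to less than \<open>e\<^sup>2\<close>.\<close>
    then obtain N where N: "1 / real (Suc N) < e\<^sup>2 / 4"
      using nat_approx_posE[of "e\<^sup>2 / 4"] by auto
    have Q_less: "Q (X n) < m + e\<^sup>2 / 4" if "N \<le> n" for n
    proof -
      have "1 / real (Suc n) \<le> 1 / real (Suc N)"
        using that by (intro divide_left_mono) auto
      then show ?thesis using X[of n] N by linarith
    qed
    have "dist (X i) (X j) < e" if "N \<le> i" "N \<le> j" for i j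
    proof (rule power_less_imp_less_base)
      show "(dist (X i) (X j))\<^sup>2 < e\<^sup>2"
        using dist_bound[of "X i" "X j"] Q_less[OF that(1)] Q_less[OF that(2)]
        by (simp add: dist_norm)
    qed (use \<open>0 < e\<close> in simp)
    then show "\<exists>M. \<forall>i\<ge>M. \<forall>j\<ge>M. dist (X i) (X j) < e"
      by blast
  qed
  \<comment> \<open>Completeness of the space enters here.\<close>
  then obtain z where z: "X \<longlonglongrightarrow> z"
    using Cauchy_convergent convergent_def by blast
  have "(\<lambda>n. Q (X n)) \<longlonglongrightarrow> Q z"
    unfolding Q_def by (intro tendsto_intros g.tendsto z)
  moreover have "(\<lambda>n. m + 1 / real (Suc n)) \<longlonglongrightarrow> m + 0"
    by (intro tendsto_add tendsto_const LIMSEQ_Suc[OF lim_1_over_n])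
  ultimately have "Q z \<le> m + 0"
    by (rule LIMSEQ_le) (use X in \<open>meson less_imp_le\<close>)
  then have Q_min: "Q z \<le> Q x" for x
    using m_le[of x] by simp
  have "g x = Re (cinner x z)" for x
  proof -
    \<comment> \<open>The right side is \<open>Q (z + t *\<^sub>R x) - Q z\<close>.\<close>
    have "0 \<le> t * (2 * (Re (cinner x z) - g x)) + t\<^sup>2 * (norm x)\<^sup>2" for t
      using Q_min[of "z + t *\<^sub>R x"]
      by (simp add: Q_def norm_add_square g.add g.scaleR cinner_scaleR_right
          Re_cinner_commute[of z x] power_mult_distrib algebra_simps)
    then show ?thesis
      using linear_coeff_eq_0 by fastforce
  qed
  then show ?thesis by blast
qed

text \<open>For fixed \<open>y\<close>, the real functional \<open>Re (cinner (S x) y)\<close> of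
  \<open>x\<close> is represented by some \<open>z\<close>; complex linearity of \<open>S\<close>
  then recovers the imaginary part.\<close>

lemma ex_cinner_representation:
  fixes S :: "'a::complex_hilbert_space \<Rightarrow> 'a"
  assumes "bounded_clinear S"
  shows "\<exists>z. \<forall>x. cinner (S x) y = cinner x z"
proof -
  interpret S: bounded_linear S
    using assms by (simp add: bounded_clinear_def)
  have S_scaleC: "S (c *\<^sub>C x) = c *\<^sub>C S x" for c x
    using assms by (simp add: bounded_clinear_def)
  obtain K where K: "\<And>x. norm (S x) \<le> norm x * K"
    using S.bounded by blast
  have "bounded_linear (\<lambda>x. Re (cinner (S x) y))"
  proof (rule bounded_linear_intro)
    show "norm (Re (cinner (S x) y)) \<le> norm x * (K * norm y)" for x
      using abs_Re_cinner_le_norm[of "S x" y] mult_right_mono[OF K[of x], of "norm y"]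
      by (simp add: mult.assoc)
  qed (simp_all add: S.add S.scaleR cinner_add_left cinner_scaleR_left)
  then obtain z where z: "\<And>x. Re (cinner (S x) y) = Re (cinner x z)"
    using real_riesz_representation by blast
  \<comment> \<open>Replacing \<open>x\<close> by \<open>\<i> *\<^sub>C x\<close> turns the real
    part into minus the imaginary part.\<close>
  have "cinner (S x) y = cinner x z" for x
    using z[of x] z[of "\<i> *\<^sub>C x"]
    by (simp add: S_scaleC cinner_scaleC_left complex_eq_iff)
  then show ?thesis by blast
qed

text \<open>Since \<open>cadjoint\<close> is a definite description, its property is available only
  after existence and uniqueness of a bounded complex-linear adjoint are shown.\<close>

lemma cinner_cadjoint:
  fixes S :: "'a::complex_hilbert_space \<Rightarrow> 'a"
  assumes "bounded_clinear S"
  shows "cinner (S x) y = cinner x (cadjoint S y)"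
proof -
  let ?P = "\<lambda>T. bounded_clinear T \<and> (\<forall>x y. cinner (S x) y = cinner x (T y))"
  obtain T where T: "\<And>x y. cinner (S x) y = cinner x (T y)"
    using ex_cinner_representation[OF assms] by metis
  obtain K where K: "\<And>x. norm (S x) \<le> norm x * K" "K \<ge> 0"
    using assms bounded_linear.nonneg_bounded unfolding bounded_clinear_def by blast
  have T_add: "T (u + v) = T u + T v" for u v
    by (rule cinner_ext) (simp add: cinner_add_right flip: T)
  have T_scaleC: "T (c *\<^sub>C u) = c *\<^sub>C T u" for c u
    by (rule cinner_ext) (simp add: cinner_scaleC_right flip: T)
  \<comment> \<open>Testing the adjoint relation at \<open>x = T y\<close> bounds the square of
    \<open>norm (T y)\<close>; one factor is cancelled, hence the case split.\<close>
  have T_bound: "norm (T y) \<le> norm y * K" for y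
  proof (cases "T y = 0")
    case True
    then show ?thesis using K(2) by simp
  next
    case False
    have "norm (T y) * norm (T y) = Re (cinner (S (T y)) y)"
      by (simp add: T cinner_self power2_eq_square)
    also have "\<dots> \<le> norm (S (T y)) * norm y"
      by (rule Re_cinner_le_norm)
    also have "\<dots> \<le> norm (T y) * K * norm y"
      by (intro mult_right_mono K) simp
    finally show ?thesis
      using False by (simp add: mult_ac)
  qed
  have "bounded_linear T"
    by (rule bounded_linear_intro[where K = K])
      (simp_all add: T_add T_bound scaleR_scaleC T_scaleC)
  then have "?P T"
    by (simp add: bounded_clinear_def T_scaleC T)
  moreover have "T' = T" if "?P T'" for T'
    using that T by (metis cinner_ext ext)
  ultimately have "?P (cadjoint S)"
    unfolding cadjoint_def by (rule theI)
  then show ?thesis by blast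
qed

theorem lemma4:
  fixes S :: "'a::complex_hilbert_space \<Rightarrow> 'a"
  assumes "bounded_clinear S"
  shows "euclidean_operator_radius [S, cadjoint S \<circ> S] = davis_wielandt_radius S"
proof -
  have "cmod (cinner (cadjoint S (S x)) x) = (norm (S x))\<^sup>2" for x
  proof -
    \<comment> \<open>The adjoint stands in the first slot here, so moving it costs a conjugation,
      which the modulus ignores.\<close>
    have "cinner (cadjoint S (S x)) x = cnj (cinner (S x) (S x))"
      unfolding cinner_cadjoint[OF assms, of x] by (rule cinner_commute)
    then show ?thesis by (simp add: cinner_self norm_power)
  qed
  \<comment> \<open>The functions under both suprema agree pointwise, as the square of
    \<open>(norm (S x))\<^sup>2\<close> is the fourth power; this covers the zero space too, where
    both radii are \<open>Sup {}\<close>.\<close>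
  then show ?thesis
    by (simp add: euclidean_operator_radius_def davis_wielandt_radius_def)
qed

end
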